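(* Let $G$ be a twin graph on $n=|V(G)|$ vertices and suppose that $n$ is odd. Let $\pi^*=\{C_1,C_2,\ldots,C_t,\{v_n\}\}$, with $t=\frac{n-1}{2}$, denote the twin partition of $G$. If the quotient graph $G_{\pi^*}$ has a non-trivial almost equitable partition of the form $\rho=\{S_1,S_2,\ldots,S_m,\{\{v_n\}\}\}$ (so that $\{S_1,\ldots,S_m\}$ is a partition of $\{C_1,\ldots,C_t\}$, and the vertex $\{v_n\}$ of $G_{\pi^*}$ forms a singleton cell of $\rho$), then $G$ is strongly uncontrollable.
   Context: Graphs are finite. A weighted digraph is a triple $G=(V,E,\phi)$ with no loops, $E\subset V\times V$, and weight function $\phi$ on ordered pairs with values in $\{0,1,2,\ldots\}$ such that $\phi(u,v)\ne 0$ iff $(u,v)\in E$. A simple graph is one with $(u,v)\in E$ iff $(v,u)\in E$, all edge weights being $1$. For $u\in V$ and $C\subseteq V$, $\deg(u,C)=\sum_{v\in C}\phi(u,v)$ and $\deg(u)=\deg(u,V)$. The Laplacian matrix of a graph with vertices $v_1,\ldots,v_n$ is $L(G)=D-A$, where $A_{i,j}=\phi(v_i,v_j)$ and $D$ is the diagonal matrix of degrees $\deg(v_i)$. Almost equitable partition (AEP): a partition $\pi=\{C_1,\ldots,C_k\}$ of $V$ into nonempty cells is an AEP of $G$ if for all $i\ne j$, $\deg(u,C_j)=\deg(v,C_j)$ for all $u,v\in C_i$; this common value is denoted $\deg(C_i,C_j)$. The quotient graph $G_\pi$ is the weighted digraph with vertex set $\pi$ and weights $\phi(C_i,C_j)=\deg(C_i,C_j)$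 for $i\neq j$ (an arc being present iff the weight is nonzero). A partition is non-trivial here if it is not the discrete partition, i.e., at least one of its cells has at least two elements. Twins: in a simple graph $G$, with $N(u)$ the set of neighbors of $u$, two distinct vertices $u,v$ are twins if $N(u)\setminus\{v\}=N(v)\setminus\{u\}$. The number of twins of $G$ means the number of unordered twin pairs $\{u,v\}$. A matrix has simple spectrum if every eigenvalue has algebraic multiplicity one. A simple graph $G$ on $n$ vertices is a twin graph if $L(G)$ has simple spectrum and the number of twins of $G$ equals $t=\lfloor\frac{n-1}{2}\rfloor$ (the twin pairs are then pairwise disjoint). Twin partition: for a twin graph with $n$ odd, the vertices are labeled so that the $t=\frac{n-1}{2}$ twin pairs are $C_1=\{v_1,v_2\},C_2=\{v_3,v_4\},\ldots,C_t=\{v_{n-2},v_{n-1}\}$, and $v_n$ is the remaining (non-twin) vertex; the twin partition is $\pi^*=\{C_1,\ldots,C_t,\{v_n\}\}$, which is an AEP of $G$. Controllability: for $L\in\mathbb{R}^{n\times n}$ and $b\in\mathbb{R}^n$, $(L,b)$ is controllable if $\mathrm{span}\{b,Lb,\ldots,L^{n-1}b\}=\mathbb{R}^n$, and uncontrollable otherwise. A simple connected graph $G$ on $n$ vertices is strongly uncontrollable if $L=L(G)$ has simple spectrum and $(L,b)$ is uncontrollable for every $b\in\{0,1\}^n$. *)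

theory Defs
  imports
    "Graph_Theory.Graph_Theory"
    "Jordan_Normal_Form.Char_Poly"
    "Jordan_Normal_Form.VS_Connect"
    "HOL-Library.Disjoint_Sets"
begin

text \<open>A value of type \<open>'a wdigraph\<close> encodes a triple \<open>(V, E, \<phi>)\<close>: the vertices and arcs come
  from the digraphs without parallel arcs of the library, \<open>\<phi>\<close> is the field \<open>weight\<close>.\<close>

record 'a wdigraph = "'a pair_pre_digraph" +
  weight :: "'a \<Rightarrow> 'a \<Rightarrow> nat"

abbreviation underlying :: "'a wdigraph \<Rightarrow> 'a pair_pre_digraph" where
  "underlying G \<equiv> pair_pre_digraph.truncate G"

text \<open>\<open>pair_digraph\<close> and \<open>pair_graph\<close> include finiteness, \<open>E \<subseteq> V \<times> V\<close> and absence of loops;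
  \<open>pair_graph\<close> also symmetry. Values of \<open>weight\<close> outside \<open>V \<times> V\<close> are irrelevant.\<close>

definition weighted_digraph :: "'a wdigraph \<Rightarrow> bool" where
  "weighted_digraph G \<longleftrightarrow> pair_digraph (underlying G) \<and>
     (\<forall>u\<in>pverts G. \<forall>v\<in>pverts G. weight G u v \<noteq> 0 \<longleftrightarrow> (u, v) \<in> parcs G)"

definition simple_graph :: "'a wdigraph \<Rightarrow> bool" where
  "simple_graph G \<longleftrightarrow> weighted_digraph G \<and> pair_graph (underlying G) \<and>
     (\<forall>(u, v)\<in>parcs G. weight G u v = 1)"

definition deg_into :: "'a wdigraph \<Rightarrow> 'a \<Rightarrow> 'a set \<Rightarrow> nat" where
  "deg_into G u C = (\<Sum>v\<in>C. weight G u v)"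

definition deg :: "'a wdigraph \<Rightarrow> 'a \<Rightarrow> nat" where
  "deg G u = deg_into G u (pverts G)"


subsection \<open>Laplacian matrix and controllability\<close>

text \<open>A labeling \<open>v\<^sub>1, \<dots>, v\<^sub>n\<close> of the vertices is a list \<open>vs\<close> with \<open>v\<^sub>i = vs ! (i - 1)\<close>.\<close>

definition labeling :: "'a wdigraph \<Rightarrow> 'a list \<Rightarrow> bool" where
  "labeling G vs \<longleftrightarrow> distinct vs \<and> set vs = pverts G"

definition adjacency_matrix :: "'a wdigraph \<Rightarrow> 'a list \<Rightarrow> real mat" where
  "adjacency_matrix G vs =
     mat (length vs) (length vs) (\<lambda>(i, j). real (weight G (vs ! i) (vs ! j)))"

definition degree_matrix :: "'a wdigraph \<Rightarrow> 'a list \<Rightarrow> real mat" where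
  "degree_matrix G vs =
     mat (length vs) (length vs) (\<lambda>(i, j). if i = j then real (deg G (vs ! i)) else 0)"

definition laplacian :: "'a wdigraph \<Rightarrow> 'a list \<Rightarrow> real mat" where
  "laplacian G vs = degree_matrix G vs - adjacency_matrix G vs"

text \<open>All complex eigenvalues are counted; for the symmetric Laplacian of a simple graph these
  are the real ones.\<close>

definition simple_spectrum :: "real mat \<Rightarrow> bool" where
  "simple_spectrum A \<longleftrightarrow>
     (let B = map_mat complex_of_real A in
      \<forall>x. eigenvalue B x \<longrightarrow> Polynomial.order x (char_poly B) = 1)"

definition controllable :: "real mat \<Rightarrow> real vec \<Rightarrow> bool" where
  "controllable L b \<longleftrightarrow>
     (let n = dim_row L in
      LinearCombinations.module.span class_ring (module_vec TYPE(real) n)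
        {(L ^\<^sub>m k) *\<^sub>v b | k. k < n} = carrier_vec n)"

text \<open>Relabeling the vertices conjugates the Laplacian by a permutation matrix and permutes the
  entries of \<open>b\<close>, so the quantifiers over labelings below could equally be existential.\<close>

definition laplacian_simple_spectrum :: "'a wdigraph \<Rightarrow> bool" where
  "laplacian_simple_spectrum G \<longleftrightarrow> (\<forall>vs. labeling G vs \<longrightarrow> simple_spectrum (laplacian G vs))"

definition strongly_uncontrollable :: "'a wdigraph \<Rightarrow> bool" where
  "strongly_uncontrollable G \<longleftrightarrow>
     simple_graph G \<and> Digraph_Component.connected (with_proj (underlying G)) \<and> laplacian_simple_spectrum G \<and>
     (\<forall>vs. labeling G vs \<longrightarrow>
        (\<forall>b\<in>carrier_vec (card (pverts G)).
           (\<forall>i<card (pverts G). b $ i \<in> {0, 1}) \<longrightarrow> \<not> controllable (laplacian G vs) b))"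


subsection \<open>Almost equitable partitions and quotient graphs\<close>

definition almost_equitable_partition :: "'a wdigraph \<Rightarrow> 'a set set \<Rightarrow> bool" where
  "almost_equitable_partition G \<pi> \<longleftrightarrow> partition_on (pverts G) \<pi> \<and>
     (\<forall>C\<in>\<pi>. \<forall>D\<in>\<pi>. C \<noteq> D \<longrightarrow> (\<forall>u\<in>C. \<forall>v\<in>C. deg_into G u D = deg_into G v D))"

definition nontrivial_partition :: "'a set set \<Rightarrow> bool" where
  "nontrivial_partition \<pi> \<longleftrightarrow> (\<exists>C\<in>\<pi>. card C \<ge> 2)"

definition cell_deg :: "'a wdigraph \<Rightarrow> 'a set \<Rightarrow> 'a set \<Rightarrow> nat" where
  "cell_deg G C D = (THE d. \<forall>u\<in>C. deg_into G u D = d)"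

definition quotient_graph :: "'a wdigraph \<Rightarrow> 'a set set \<Rightarrow> 'a set wdigraph" where
  "quotient_graph G \<pi> =
     \<lparr> pverts = \<pi>,
       parcs = {(C, D). C \<in> \<pi> \<and> D \<in> \<pi> \<and> C \<noteq> D \<and> cell_deg G C D \<noteq> 0},
       weight = (\<lambda>C D. if C = D then 0 else cell_deg G C D) \<rparr>"


subsection \<open>Twin graphs\<close>

definition neighbors :: "'a wdigraph \<Rightarrow> 'a \<Rightarrow> 'a set" where
  "neighbors G u = {v \<in> pverts G. (u, v) \<in> parcs G}"

definition twins :: "'a wdigraph \<Rightarrow> 'a \<Rightarrow> 'a \<Rightarrow> bool" where
  "twins G u v \<longleftrightarrow> u \<in> pverts G \<and> v \<in> pverts G \<and> u \<noteq> v \<and>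
     neighbors G u - {v} = neighbors G v - {u}"

definition twin_pairs :: "'a wdigraph \<Rightarrow> 'a set set" where
  "twin_pairs G = {{u, v} | u v. twins G u v}"

definition twin_graph :: "'a wdigraph \<Rightarrow> bool" where
  "twin_graph G \<longleftrightarrow> simple_graph G \<and> laplacian_simple_spectrum G \<and>
     card (twin_pairs G) = (card (pverts G) - 1) div 2"

text \<open>For odd \<open>n\<close>, a labeling in which \<open>{v\<^sub>1, v\<^sub>2}, {v\<^sub>3, v\<^sub>4}, \<dots>, {v\<^sub>n\<^sub>-\<^sub>2, v\<^sub>n\<^sub>-\<^sub>1}\<close> are twin pairs. In a
  twin graph these are \<open>t\<close> distinct pairs, hence all of them.\<close>

definition twin_labeling :: "'a wdigraph \<Rightarrow> 'a list \<Rightarrow> bool" where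
  "twin_labeling G vs \<longleftrightarrow> labeling G vs \<and>
     (\<forall>i<(length vs - 1) div 2. twins G (vs ! (2 * i)) (vs ! (2 * i + 1)))"

definition twin_partition :: "'a list \<Rightarrow> 'a set set" where
  "twin_partition vs =
     {{vs ! (2 * i), vs ! (2 * i + 1)} | i. i < (length vs - 1) div 2} \<union> {{last vs}}"

end

theory Submission
  imports Defs
begin

text \<open>
  If a nonzero vector \<open>y\<close> lies in a subspace that is invariant under the symmetric matrix \<open>L\<close> and
  orthogonal to \<open>b\<close>, then \<open>y\<close> is orthogonal to every \<open>L\<^sup>k b\<close>, so \<open>(L, b)\<close> is uncontrollable
  (\<open>not_controllable_if_orthogonal_invariant\<close>). This replaces the usual eigenvector criterion and
  avoids diagonalization. An almost equitable partition supplies two invariant subspaces: the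
  functions that are constant on each cell (\<open>lap_cell_constant\<close>) and, as the orthogonal complement
  of these, the functions that sum to zero over each cell (\<open>lap_zero_sum\<close>).

  Let \<open>b\<close> be a binary vector. If \<open>b\<close> agrees on some twins \<open>u, v\<close>, the partition into \<open>{u, v}\<close> and
  singletons is almost equitable, and its zero-sum functions are the multiples of
  \<open>e\<^sub>u - e\<^sub>v\<close>, which are orthogonal to \<open>b\<close> (\<open>twins_equal_not_controllable\<close>).
  Otherwise \<open>b\<close> has exactly one entry 1 on every twin pair. The partition \<open>\<rho>\<close> of the quotient lifts
  to an almost equitable partition of \<open>G\<close> by uniting the members of each of its cells
  (\<open>almost_equitable_partition_lift\<close>). The functions that are constant on twin pairs and sum to
  zero over the lifted cells form an invariant subspace. Such a function \<open>f\<close> vanishes at the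
  non-twin vertex, so its inner product with \<open>b\<close> is the sum of one value per pair, half of the total
  sum of \<open>f\<close>, hence 0. A cell of \<open>\<rho>\<close> with two distinct pairs \<open>C, D\<close> gives the nonzero element
  \<open>1\<^sub>C - 1\<^sub>D\<close> (\<open>twin_separating_not_controllable\<close>).

  Strong uncontrollability includes connectedness. If a set of vertices had no arcs to or from
  its nonempty complement, listing it first would make the Laplacian block diagonal, each block with
  zero row sums, and 0 would be a root of the characteristic polynomial of order at least 2, against
  the simple spectrum (\<open>simple_spectrum_no_separation\<close>).
\<close>


section \<open>The Laplacian as an operator on functions\<close>

text \<open>Working with functions on vertices instead of vectors makes the arguments independent of the
  labeling. The difference form hides the degree and shows at once that only values that differ
  from \<open>f u\<close> contribute.\<close>

definition lap :: "'a wdigraph \<Rightarrow> ('a \<Rightarrow> real) \<Rightarrow> 'a \<Rightarrow> real" where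
  "lap G f u = (\<Sum>w\<in>pverts G. real (weight G u w) * (f u - f w))"

lemma sum_labeling:
  assumes "labeling G ws"
  shows "(\<Sum>i<length ws. g (ws ! i)) = (\<Sum>u\<in>pverts G. g u)"
proof -
  have "bij_betw ((!) ws) {..<length ws} (pverts G)"
    using assms by (auto simp: labeling_def intro: bij_betw_nth)
  then show ?thesis by (rule sum.reindex_bij_betw)
qed

lemma laplacian_mult_vec:
  assumes ws: "labeling G ws"
  shows "laplacian G ws *\<^sub>v vec (length ws) (\<lambda>i. f (ws ! i))
    = vec (length ws) (\<lambda>i. lap G f (ws ! i))" (is "?L *\<^sub>v ?f = ?g")
proof (rule eq_vecI)
  fix i assume "i < dim_vec ?g"
  then have i: "i < length ws" by simp
  have "(?L *\<^sub>v ?f) $ i = (\<Sum>j<length ws. ?L $$ (i, j) * f (ws ! j))"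
    using i by (auto simp: laplacian_def degree_matrix_def adjacency_matrix_def scalar_prod_def
        lessThan_atLeast0 intro!: sum.cong)
  also have "\<dots> = (\<Sum>j<length ws. (if i = j then real (deg G (ws ! i)) * f (ws ! i) else 0)
      - real (weight G (ws ! i) (ws ! j)) * f (ws ! j))"
    using i by (intro sum.cong) (auto simp: laplacian_def degree_matrix_def adjacency_matrix_def algebra_simps)
  also have "\<dots> = real (deg G (ws ! i)) * f (ws ! i)
      - (\<Sum>j<length ws. real (weight G (ws ! i) (ws ! j)) * f (ws ! j))"
    using i by (simp add: sum_subtractf)
  also have "\<dots> = lap G f (ws ! i)"
    unfolding sum_labeling[OF ws, where g = "\<lambda>w. real (weight G (ws ! i) w) * f w"] lap_def
    by (simp add: deg_def deg_into_def sum_distrib_right sum_subtractf right_diff_distrib)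
  finally show "(?L *\<^sub>v ?f) $ i = ?g $ i" using i by simp
qed (simp add: laplacian_def degree_matrix_def adjacency_matrix_def)

lemma laplacian_carrier: "laplacian G ws \<in> carrier_mat (length ws) (length ws)"
  by (auto simp: laplacian_def degree_matrix_def adjacency_matrix_def)

lemma laplacian_pow_mult_vec:
  assumes ws: "labeling G ws"
  shows "(laplacian G ws ^\<^sub>m k) *\<^sub>v vec (length ws) (\<lambda>i. f (ws ! i))
    = vec (length ws) (\<lambda>i. (lap G ^^ k) f (ws ! i))"
proof (induction k arbitrary: f)
  case 0
  show ?case using laplacian_carrier[of G ws] by simp
next
  case (Suc k)
  have c: "laplacian G ws ^\<^sub>m k \<in> carrier_mat (length ws) (length ws)"
    by (rule pow_carrier_mat[OF laplacian_carrier])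
  have "(laplacian G ws ^\<^sub>m Suc k) *\<^sub>v vec (length ws) (\<lambda>i. f (ws ! i))
    = (laplacian G ws ^\<^sub>m k) *\<^sub>v (laplacian G ws *\<^sub>v vec (length ws) (\<lambda>i. f (ws ! i)))"
    by (simp add: assoc_mult_mat_vec[OF c laplacian_carrier])
  then show ?case
    by (simp add: laplacian_mult_vec[OF ws] Suc.IH funpow_swap1)
qed

definition symmetric_weights :: "'a wdigraph \<Rightarrow> bool" where
  "symmetric_weights G \<longleftrightarrow> (\<forall>u\<in>pverts G. \<forall>v\<in>pverts G. weight G u v = weight G v u)"

lemma lap_self_adjoint:
  assumes "symmetric_weights G"
  shows "(\<Sum>u\<in>pverts G. g u * lap G f u) = (\<Sum>u\<in>pverts G. lap G g u * f u)"
proof -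
  let ?V = "pverts G" and ?w = "\<lambda>u v. real (weight G u v)"
  have "(\<Sum>u\<in>?V. \<Sum>v\<in>?V. ?w u v * (g u * f v)) = (\<Sum>u\<in>?V. \<Sum>v\<in>?V. ?w v u * (g v * f u))"
    by (rule sum.swap)
  also have "\<dots> = (\<Sum>u\<in>?V. \<Sum>v\<in>?V. ?w u v * (g v * f u))"
    using assms by (intro sum.cong) (auto simp: symmetric_weights_def)
  finally show ?thesis
    by (simp add: lap_def sum_distrib_left sum_distrib_right sum_subtractf algebra_simps)
qed

text \<open>Self-adjointness moves \<open>k\<close> applications of the Laplacian from \<open>\<beta>\<close> to an element of \<open>U\<close>, which
  stays in \<open>U\<close>; hence \<open>y\<close> is orthogonal to all generators of the Krylov space and, if these
  spanned everything, to itself.\<close>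

lemma not_controllable_if_orthogonal_invariant:
  assumes ws: "labeling G ws" and sym: "symmetric_weights G"
    and inv: "\<And>f. f \<in> U \<Longrightarrow> lap G f \<in> U"
    and orth: "\<And>f. f \<in> U \<Longrightarrow> (\<Sum>u\<in>pverts G. f u * \<beta> u) = 0"
    and y: "y \<in> U" "u \<in> pverts G" "y u \<noteq> 0"
  shows "\<not> controllable (laplacian G ws) (vec (length ws) (\<lambda>i. \<beta> (ws ! i)))"
proof
  let ?n = "length ws" and ?L = "laplacian G ws"
  let ?b = "vec ?n (\<lambda>i. \<beta> (ws ! i))" and ?y = "vec ?n (\<lambda>i. y (ws ! i))"
  let ?K = "{(?L ^\<^sub>m k) *\<^sub>v ?b | k. k < ?n}"
  interpret vec_space "TYPE(real)" ?n .
  assume "controllable ?L ?b"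
  then have span: "span ?K = carrier_vec ?n"
    using laplacian_carrier[of G ws] by (simp add: controllable_def Let_def)
  have K: "?K \<subseteq> carrier_vec ?n"
    by (auto simp: laplacian_pow_mult_vec[OF ws])
  have krylov: "(\<Sum>u\<in>pverts G. f u * (lap G ^^ k) \<beta> u) = 0" if "f \<in> U" for f k
    using that
  proof (induction k arbitrary: f)
    case (Suc k)
    then show ?case using lap_self_adjoint[OF sym, of f "(lap G ^^ k) \<beta>"] inv by simp
  qed (simp add: orth)
  have "?y \<bullet> x = 0" if "x \<in> ?K" for x
  proof -
    from that obtain k where "x = vec ?n (\<lambda>i. (lap G ^^ k) \<beta> (ws ! i))"
      by (auto simp: laplacian_pow_mult_vec[OF ws])
    then have "?y \<bullet> x = (\<Sum>i<?n. y (ws ! i) * (lap G ^^ k) \<beta> (ws ! i))"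
      by (simp add: scalar_prod_def lessThan_atLeast0)
    then show ?thesis
      using krylov[OF y(1)] sum_labeling[OF ws, of "\<lambda>u. y u * (lap G ^^ k) \<beta> u"] by simp
  qed
  then have "?y \<in> orthogonal_complement ?K"
    by (auto simp: orthogonal_complement_def)
  then have "?y \<in> orthogonal_complement (carrier_vec ?n)"
    using in_orthogonal_complement_span[OF K] span by simp
  then have "?y \<bullet> ?y = 0" by (auto simp: orthogonal_complement_def)
  then have "(\<Sum>i<?n. y (ws ! i) * y (ws ! i)) = 0"
    by (simp add: scalar_prod_def lessThan_atLeast0)
  then have "\<forall>i\<in>{..<?n}. y (ws ! i) * y (ws ! i) = 0"
    by (subst (asm) sum_nonneg_eq_0_iff) auto
  moreover obtain i where "i < ?n" "ws ! i = u"
    using ws y(2) by (metis in_set_conv_nth labeling_def)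
  ultimately show False using y(3) by auto
qed


section \<open>Almost equitable partitions\<close>

text \<open>The sum that defines \<open>lap G f u\<close> splits over the cells. The own cell of \<open>u\<close> contributes 0,
  whatever the weights inside it, and any other cell \<open>D\<close> contributes
  \<open>deg_into G u D * (f u - f d)\<close> with \<open>d \<in> D\<close>, which depends only on the cell of \<open>u\<close>.\<close>

lemma lap_cell_constant:
  assumes fin: "finite (pverts G)" and P: "almost_equitable_partition G P"
    and f: "\<And>C u v. C \<in> P \<Longrightarrow> u \<in> C \<Longrightarrow> v \<in> C \<Longrightarrow> f u = f v"
    and C: "C \<in> P" "u \<in> C" "v \<in> C"
  shows "lap G f u = lap G f v"
proof -
  have part: "partition_on (pverts G) P" and
    aep: "\<And>C D u v. C \<in> P \<Longrightarrow> D \<in> P \<Longrightarrow> C \<noteq> D \<Longrightarrow> u \<in> C \<Longrightarrow> v \<in> C \<Longrightarrow> deg_into G u D = deg_into G v D"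
    using P unfolding almost_equitable_partition_def by blast+
  have split: "lap G f x = (\<Sum>D\<in>P. \<Sum>w\<in>D. real (weight G x w) * (f x - f w))" for x
    unfolding lap_def by (rule sum.partition[OF fin part])
  have "(\<Sum>w\<in>D. real (weight G u w) * (f u - f w)) = (\<Sum>w\<in>D. real (weight G v w) * (f v - f w))"
    if D: "D \<in> P" for D
  proof (cases "D = C")
    case True
    then have "f u - f w = 0" "f v - f w = 0" if "w \<in> D" for w
      using f[of C u w] f[of C v w] C that True by simp_all
    then show ?thesis by simp
  next
    case False
    obtain d where d: "d \<in> D" using partition_onD3[OF part] D by fastforce
    have "(\<Sum>w\<in>D. real (weight G x w) * (f x - f w)) = real (deg_into G x D) * (f x - f d)" for x
      unfolding deg_into_def of_nat_sum sum_distrib_right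
      by (rule sum.cong[OF refl]) (metis f[OF D _ d])
    moreover have "deg_into G u D = deg_into G v D"
      using aep[OF C(1) D _ C(2,3)] False by blast
    ultimately show ?thesis using f[OF C] by metis
  qed
  then show ?thesis unfolding split by (rule sum.cong[OF refl])
qed

text \<open>The dual of \<open>lap_cell_constant\<close>: a function has zero cell sums iff it is orthogonal to the
  indicators of all cells, and the Laplacian, being self-adjoint, may be moved to the indicator,
  where the result is again constant on cells.\<close>

lemma lap_zero_sum:
  assumes fin: "finite (pverts G)" and sym: "symmetric_weights G"
    and P: "almost_equitable_partition G P"
    and f: "\<And>C. C \<in> P \<Longrightarrow> (\<Sum>u\<in>C. f u) = 0"
    and C: "C \<in> P"
  shows "(\<Sum>u\<in>C. lap G f u) = 0"
proof -
  let ?V = "pverts G" and ?g = "\<lambda>u. if u \<in> C then 1 else 0 :: real"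
  have part: "partition_on ?V P" using P by (simp add: almost_equitable_partition_def)
  have CV: "C \<subseteq> ?V" using part C by (auto simp: partition_on_def)
  have g: "?g u = ?g v" if "D \<in> P" "u \<in> D" "v \<in> D" for D u v
    using partition_onD2[OF part] that C by (auto dest: disjointD)
  have "(\<Sum>u\<in>C. lap G f u) = (\<Sum>u\<in>?V. ?g u * lap G f u)"
    using CV fin by (intro sum.mono_neutral_cong_left) auto
  also have "\<dots> = (\<Sum>u\<in>?V. lap G ?g u * f u)" by (rule lap_self_adjoint[OF sym])
  also have "\<dots> = (\<Sum>D\<in>P. \<Sum>u\<in>D. lap G ?g u * f u)"
    by (rule sum.partition[OF fin part])
  also have "\<dots> = 0"
  proof (rule sum.neutral, rule ballI)
    fix D assume D: "D \<in> P"
    then obtain d where d: "d \<in> D" using partition_onD3[OF part] by fastforce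
    have "lap G ?g u = lap G ?g d" if "u \<in> D" for u
      by (rule lap_cell_constant[OF fin P g D that d])
    then have "(\<Sum>u\<in>D. lap G ?g u * f u) = (\<Sum>u\<in>D. lap G ?g d * f u)"
      by (intro sum.cong refl arg_cong2[where f = "(*)"])
    also have "\<dots> = 0" using f[OF D] by (simp flip: sum_distrib_left)
    finally show "(\<Sum>u\<in>D. lap G ?g u * f u) = 0" .
  qed
  finally show ?thesis .
qed

lemma Union_partition_on:
  assumes P: "partition_on V P" and R: "partition_on P R"
  shows "partition_on V (Union ` R)"
proof (rule partition_onI)
  show "\<Union> (Union ` R) = V"
    using partition_onD1[OF P] partition_onD1[OF R] by auto
  show "disjnt X Y" if XY: "X \<in> Union ` R" "Y \<in> Union ` R" "X \<noteq> Y" for X Y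
  proof -
    obtain S T where ST: "S \<in> R" "X = \<Union>S" "T \<in> R" "Y = \<Union>T" "S \<noteq> T" using XY by auto
    have "C \<inter> D = {}" if "C \<in> S" "D \<in> T" for C D
    proof -
      have "S \<inter> T = {}" using partition_onD2[OF R] ST by (auto dest: disjointD)
      moreover have "C \<in> P" "D \<in> P" using partition_onD1[OF R] ST that by auto
      ultimately show ?thesis using partition_onD2[OF P] that by (metis disjointD disjoint_iff)
    qed
    then show ?thesis using ST by (fastforce simp: disjnt_def)
  qed
  have "X \<noteq> {}" if X: "X \<in> Union ` R" for X
  proof -
    obtain S where S: "S \<in> R" "X = \<Union>S" using X by auto
    then obtain C where "C \<in> S" using partition_onD3[OF R] by fastforce
    moreover have "C \<in> P" using partition_onD1[OF R] S \<open>C \<in> S\<close> by auto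
    then have "C \<noteq> {}" using partition_onD3[OF P] by auto
    ultimately show ?thesis using S by auto
  qed
  then show "{} \<notin> Union ` R" by blast
qed

text \<open>For \<open>u\<close> in a cell \<open>C \<in> S\<close>, the degree into \<open>\<Union>T\<close> is the sum of the cell degrees from \<open>C\<close> to
  the members of \<open>T\<close>, that is, the degree of \<open>C\<close> into \<open>T\<close> in the quotient graph. The quotient has
  weight 0 on its diagonal; as \<open>C \<notin> T\<close>, no diagonal weight enters.\<close>

lemma almost_equitable_partition_lift:
  assumes fin: "finite (pverts G)" and P: "almost_equitable_partition G P"
    and R: "almost_equitable_partition (quotient_graph G P) R"
  shows "almost_equitable_partition G (Union ` R)"
proof -
  let ?Q = "quotient_graph G P"
  have part: "partition_on (pverts G) P" using P by (simp add: almost_equitable_partition_def)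
  have partR: "partition_on P R"
    using R by (simp add: almost_equitable_partition_def quotient_graph_def)
  have "finite P" using finite_elements[OF fin part] .
  have deg: "deg_into G u (\<Union>T) = deg_into ?Q C T"
    if "S \<in> R" "T \<in> R" "S \<noteq> T" "C \<in> S" "u \<in> C" for S T C u
  proof -
    have CT: "C \<notin> T" using partition_onD2[OF partR] that by (auto dest: disjointD)
    have "C \<in> P" "T \<subseteq> P" using that partR by (auto simp: partition_on_def)
    have cell: "weight ?Q C D = deg_into G u D" if "D \<in> T" for D
    proof -
      have "D \<noteq> C" "D \<in> P" using that CT \<open>T \<subseteq> P\<close> by auto
      then have "deg_into G v D = deg_into G u D" if "v \<in> C" for v
        using P \<open>C \<in> P\<close> \<open>u \<in> C\<close> that unfolding almost_equitable_partition_def by blast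
      then have "cell_deg G C D = deg_into G u D"
        unfolding cell_deg_def using \<open>u \<in> C\<close> by (intro the_equality) metis+
      then show ?thesis using \<open>D \<noteq> C\<close> by (simp add: quotient_graph_def)
    qed
    have "deg_into G u (\<Union>T) = (\<Sum>D\<in>T. deg_into G u D)"
      unfolding deg_into_def
    proof (subst sum.Union_disjoint)
      show "\<forall>A\<in>T. finite A" using \<open>T \<subseteq> P\<close> part fin
        by (metis Union_upper finite_subset partition_onD1 subsetD)
      show "\<forall>A\<in>T. \<forall>B\<in>T. A \<noteq> B \<longrightarrow> A \<inter> B = {}"
        using partition_onD2[OF part] \<open>T \<subseteq> P\<close> by (auto simp: disjoint_def)
    qed simp
    then show ?thesis by (simp add: deg_into_def[of ?Q] cell)
  qed
  show ?thesis
    unfolding almost_equitable_partition_def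
  proof (intro conjI ballI impI)
    show "partition_on (pverts G) (Union ` R)" by (rule Union_partition_on[OF part partR])
    fix X Y u v assume X: "X \<in> Union ` R" and Y: "Y \<in> Union ` R" and "X \<noteq> Y" and uv: "u \<in> X" "v \<in> X"
    then obtain S T where S: "S \<in> R" "X = \<Union>S" and T: "T \<in> R" "Y = \<Union>T" and ne: "S \<noteq> T" by auto
    obtain C D where "C \<in> S" "u \<in> C" "D \<in> S" "v \<in> D" using uv S by auto
    then have "deg_into G u Y = deg_into ?Q C T" "deg_into G v Y = deg_into ?Q D T"
      using deg S T ne by auto
    moreover have "deg_into ?Q C T = deg_into ?Q D T"
      using R S T ne \<open>C \<in> S\<close> \<open>D \<in> S\<close> unfolding almost_equitable_partition_def by blast
    ultimately show "deg_into G u Y = deg_into G v Y" by simp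
  qed
qed


section \<open>Twins\<close>

lemma simple_graph_weight:
  assumes "simple_graph G" "u \<in> pverts G" "v \<in> pverts G"
  shows "weight G u v = (if (u, v) \<in> parcs G then 1 else 0)"
  using assms by (auto simp: simple_graph_def weighted_digraph_def)

lemma simple_graph_finite: 
  assumes "simple_graph G" shows "finite (pverts G)"
proof -
  have "pair_graph (underlying G)" using assms by (simp add: simple_graph_def)
  then interpret pair_graph "underlying G" .
  show ?thesis using pair_finite_verts by (simp add: pair_pre_digraph.defs)
qed

lemma simple_graph_arcs_sym: 
  assumes "simple_graph G" "(u, v) \<in> parcs G" shows "(v, u) \<in> parcs G"
proof -
  have "pair_graph (underlying G)" using assms by (simp add: simple_graph_def)
  then interpret pair_graph "underlying G" .
  show ?thesis using arcs_symmetric[of u v] assms(2) by (simp add: pair_pre_digraph.defs)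
qed

lemma simple_graph_symmetric_weights:
  assumes "simple_graph G" shows "symmetric_weights G"
  using simple_graph_arcs_sym[OF assms]
  by (auto simp: symmetric_weights_def simple_graph_weight[OF assms])

lemma twins_weight:
  assumes G: "simple_graph G" and "twins G u v" and "w \<in> pverts G - {u, v}"
  shows "weight G u w = weight G v w"
proof -
  have "w \<in> neighbors G u \<longleftrightarrow> w \<in> neighbors G v"
    using assms unfolding twins_def by blast
  then show ?thesis using assms by (auto simp: neighbors_def twins_def simple_graph_weight[OF G])
qed

text \<open>Twins have the same neighbors outside the pair, and any other cell lies outside it.\<close>

lemma twin_cells_almost_equitable:
  assumes G: "simple_graph G" and P: "partition_on (pverts G) P"
    and tw: "\<And>C u v. C \<in> P \<Longrightarrow> u \<in> C \<Longrightarrow> v \<in> C \<Longrightarrow> u \<noteq> v \<Longrightarrow> twins G u v"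
  shows "almost_equitable_partition G P"
  unfolding almost_equitable_partition_def
proof (intro conjI P ballI impI)
  fix C D u v assume C: "C \<in> P" and D: "D \<in> P" and ne: "C \<noteq> D" and uv: "u \<in> C" "v \<in> C"
  have "D \<subseteq> pverts G - {u, v}"
    using C D ne uv partition_onD1[OF P] partition_onD2[OF P] by (auto simp: disjoint_def)
  then show "deg_into G u D = deg_into G v D"
    unfolding deg_into_def using twins_weight[OF G tw[OF C uv]]
    by (cases "u = v") (auto intro!: sum.cong)
qed


lemma twins_sym: "twins G u v \<Longrightarrow> twins G v u"
  by (auto simp: twins_def)

text \<open>The functions with zero sum over every cell of the partition into \<open>{u, v}\<close> and singletons are the multiples of \<open>e\<^sub>u - e\<^sub>v\<close>, so their
  invariance says that this vector is an eigenvector; it is orthogonal to \<open>\<beta>\<close>.\<close>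

lemma twins_equal_not_controllable:
  assumes G: "simple_graph G" and ws: "labeling G ws"
    and tw: "twins G u v" and eq: "\<beta> u = \<beta> v"
  shows "\<not> controllable (laplacian G ws) (vec (length ws) (\<lambda>i. \<beta> (ws ! i)))"
proof -
  let ?V = "pverts G" and ?P = "insert {u, v} ((\<lambda>x. {x}) ` (pverts G - {u, v}))"
  define U where "U = {f :: 'a \<Rightarrow> real. \<forall>C\<in>?P. sum f C = 0}"
  note fin = simple_graph_finite[OF G] and sym = simple_graph_symmetric_weights[OF G]
  have uv: "u \<in> ?V" "v \<in> ?V" "u \<noteq> v" using tw by (auto simp: twins_def)
  have part: "partition_on ?V ?P"
    using uv by (subst partition_on_insert) (auto simp: disjnt_def partition_on_singletons)
  have aep: "almost_equitable_partition G ?P"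
    using tw twins_sym[OF tw] by (intro twin_cells_almost_equitable[OF G part]) auto
  show ?thesis
  proof (rule not_controllable_if_orthogonal_invariant[OF ws sym, where U = U
        and u = u and y = "\<lambda>w. if w = u then 1 else if w = v then -1 else 0"])
    show "lap G f \<in> U" if "f \<in> U" for f
      using lap_zero_sum[OF fin sym aep, of f] that unfolding U_def by blast
    show "(\<Sum>w\<in>?V. f w * \<beta> w) = 0" if "f \<in> U" for f
    proof -
      have "(\<Sum>w\<in>C. f w * \<beta> w) = 0" if "C \<in> ?P" for C
      proof (cases "C = {u, v}")
        case True
        have "f u + f v = 0" using \<open>f \<in> U\<close> uv by (simp add: U_def)
        then show ?thesis using True uv eq by (simp flip: distrib_right)
      next
        case False
        then show ?thesis using \<open>f \<in> U\<close> \<open>C \<in> ?P\<close> by (auto simp: U_def)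
      qed
      then show ?thesis unfolding sum.partition[OF fin part] by (rule sum.neutral[OF ballI])
    qed
    show "(\<lambda>w. if w = u then 1 else if w = v then -1 else 0) \<in> U"
      using uv by (auto simp: U_def)
  qed (use uv in simp_all)
qed

text \<open>The hypothesis that \<open>{{z}}\<close> is a cell of \<open>R\<close> is used twice: it forces the functions in \<open>U\<close> to
  vanish at \<open>z\<close>, where \<open>\<beta>\<close> may be 0 or 1, and it ensures that a cell of \<open>R\<close>
  with two members consists of pairs only.\<close>

lemma twin_separating_not_controllable:
  assumes G: "simple_graph G" and ws: "labeling G ws"
    and P: "almost_equitable_partition G P"
    and pairs: "\<And>C. C \<in> P \<Longrightarrow> C \<noteq> {z} \<Longrightarrow> card C = 2"
    and R: "almost_equitable_partition (quotient_graph G P) R"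
    and nt: "nontrivial_partition R" and z: "{{z}} \<in> R"
    and \<beta>: "\<And>C. C \<in> P \<Longrightarrow> C \<noteq> {z} \<Longrightarrow> sum \<beta> C = (1::real)"
  shows "\<not> controllable (laplacian G ws) (vec (length ws) (\<lambda>i. \<beta> (ws ! i)))"
proof -
  let ?V = "pverts G"
  note fin = simple_graph_finite[OF G] and sym = simple_graph_symmetric_weights[OF G]
  have part: "partition_on ?V P" using P by (simp add: almost_equitable_partition_def)
  have partR: "partition_on P R"
    using R by (simp add: almost_equitable_partition_def quotient_graph_def)
  have lift: "almost_equitable_partition G (Union ` R)"
    by (rule almost_equitable_partition_lift[OF fin P R])
  have partL: "partition_on ?V (Union ` R)" by (rule Union_partition_on[OF part partR])
  define U where "U = {f :: 'a \<Rightarrow> real. (\<forall>C\<in>P. \<forall>u\<in>C. \<forall>v\<in>C. f u = f v) \<and> (\<forall>X\<in>Union ` R. sum f X = 0)}"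
  have U_const: "f u = f v" if "f \<in> U" "C \<in> P" "u \<in> C" "v \<in> C" for f C u v
    using that unfolding U_def by blast
  have U_zero: "sum f X = 0" if "f \<in> U" "X \<in> Union ` R" for f X
    using that unfolding U_def by blast
  obtain S where S: "S \<in> R" "card S \<ge> 2" using nt by (auto simp: nontrivial_partition_def)
  then obtain T where "T \<subseteq> S" "card T = 2" by (meson obtain_subset_with_card_n)
  then obtain C D where CD: "C \<in> S" "D \<in> S" "C \<noteq> D" by (auto simp: card_2_iff)
  have "S \<noteq> {{z}}" using S by auto
  then have "S \<inter> {{z}} = {}" using partition_onD2[OF partR] S(1) z by (rule_tac disjointD)
  then have "{z} \<notin> S" by blast
  moreover have CDP: "C \<in> P" "D \<in> P" using CD S partition_onD1[OF partR] by auto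
  ultimately have card: "card C = 2" "card D = 2" using CD pairs by metis+
  have disj: "C \<inter> D = {}" using partition_onD2[OF part] CDP CD by (auto simp: disjoint_def)
  \<comment> \<open>The sums of this function over \<open>C\<close> and \<open>D\<close> cancel, both pairs lying in the same cell of \<open>R\<close>.\<close>
  let ?y = "\<lambda>w. (if w \<in> C then 1 else 0) - (if w \<in> D then 1 else 0) :: real"
  obtain c where c: "c \<in> C" using card(1) by (auto simp: card_2_iff)
  show ?thesis
  proof (rule not_controllable_if_orthogonal_invariant[OF ws sym, where U = U and u = c and y = ?y])
    show "lap G f \<in> U" if f: "f \<in> U" for f
      unfolding U_def
    proof (intro CollectI conjI ballI)
      show "lap G f u = lap G f v" if "C \<in> P" "u \<in> C" "v \<in> C" for C u v
        by (rule lap_cell_constant[OF fin P U_const[OF f] that])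
      show "sum (lap G f) X = 0" if "X \<in> Union ` R" for X
        by (rule lap_zero_sum[OF fin sym lift U_zero[OF f] that])
    qed
    show "(\<Sum>w\<in>?V. f w * \<beta> w) = 0" if f: "f \<in> U" for f
    proof -
      note f_const = U_const[OF f] and f_zero = U_zero[OF f]
      have "\<Union>{{z}} \<in> Union ` R" using z by (rule imageI)
      from f_zero[OF this] have fz: "f z = 0" by simp
      \<comment> \<open>On a pair both sides equal twice the common value of \<open>f\<close>; on \<open>{z}\<close> both vanish.\<close>
      have cell: "2 * (\<Sum>w\<in>C. f w * \<beta> w) = sum f C" if C: "C \<in> P" for C
      proof (cases "C = {z}")
        case True
        then show ?thesis using fz by simp
      next
        case False
        obtain d where d: "d \<in> C" using C partition_onD3[OF part] by fastforce
        note const = f_const[OF C _ d]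
        have "(\<Sum>w\<in>C. f w * \<beta> w) = f d * sum \<beta> C"
          unfolding sum_distrib_left by (rule sum.cong[OF refl]) (metis const)
        moreover have "sum f C = (\<Sum>w\<in>C. f d)" by (rule sum.cong[OF refl const])
        ultimately show ?thesis using pairs[OF C False] \<beta>[OF C False] by simp
      qed
      have "2 * (\<Sum>w\<in>?V. f w * \<beta> w) = (\<Sum>C\<in>P. 2 * (\<Sum>w\<in>C. f w * \<beta> w))"
        by (simp add: sum.partition[OF fin part] sum_distrib_left)
      also have "\<dots> = sum f ?V"
        by (simp add: cell sum.partition[OF fin part, of f])
      also have "\<dots> = 0"
        unfolding sum.partition[OF fin partL, of f] by (rule sum.neutral) (use f_zero in blast)
      finally show ?thesis by simp
    qed
    show "?y \<in> U"
    proof -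
      have const: "?y u = ?y v" if "E \<in> P" "u \<in> E" "v \<in> E" for E u v
        using partition_onD2[OF part] that CDP by (auto dest: disjointD)
      have zero: "sum ?y (\<Union>T) = 0" if T: "T \<in> R" for T
      proof (cases "T = S")
        case True
        have "finite (\<Union>S)"
          using fin partition_onD1[OF partL] S by (metis Union_upper finite_subset imageI)
        moreover have "C \<subseteq> \<Union>S" "D \<subseteq> \<Union>S" using CD by auto
        ultimately show ?thesis using True card
          by (simp add: sum_subtractf sum.If_cases Int_absorb1 Int_def[symmetric])
      next
        case False
        have "E \<inter> C = {}" "E \<inter> D = {}" if "E \<in> T" for E
        proof -
          have "S \<inter> T = {}" using partition_onD2[OF partR] S T False by (auto dest: disjointD)
          then have "E \<noteq> C" "E \<noteq> D" "E \<in> P" using that CD T partition_onD1[OF partR] by auto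
          then show "E \<inter> C = {}" "E \<inter> D = {}" using partition_onD2[OF part] CDP by (auto simp: disjoint_def)
        qed
        then show ?thesis by (intro sum.neutral) auto
      qed
      show ?thesis unfolding U_def using const zero by blast
    qed
    show "c \<in> ?V" using c CDP partition_onD1[OF part] by auto
    show "?y c \<noteq> 0" using c disj by auto
  qed
qed

lemma twin_partition_partition_on:
  assumes "distinct vs" and len: "length vs = 2 * t + 1"
  shows "partition_on (set vs) (twin_partition vs)"
proof (rule partition_onI)
  have last: "last vs = vs ! (2 * t)" using len by (subst last_conv_nth) auto
  have tp: "twin_partition vs = {{vs ! (2 * i), vs ! (2 * i + 1)} | i. i < t} \<union> {{vs ! (2 * t)}}"
    using len by (simp add: twin_partition_def last)
  show "\<Union> (twin_partition vs) = set vs"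
  proof
    show "\<Union> (twin_partition vs) \<subseteq> set vs" unfolding tp using len by auto
    show "set vs \<subseteq> \<Union> (twin_partition vs)"
    proof
      fix x assume "x \<in> set vs"
      then obtain j where j: "j < 2 * t + 1" "x = vs ! j" using len by (metis in_set_conv_nth)
      have "(\<exists>i<t. j = 2 * i \<or> j = 2 * i + 1) \<or> j = 2 * t"
        using j(1) by presburger
      then show "x \<in> \<Union> (twin_partition vs)"
        unfolding tp using j(2) by auto
    qed
  qed
  show "disjnt p q" if "p \<in> twin_partition vs" "q \<in> twin_partition vs" "p \<noteq> q" for p q
  proof -
    have idx: "vs ! i = vs ! j \<longleftrightarrow> i = j" if "i < 2 * t + 1" "j < 2 * t + 1" for i j
      using assms that by (simp add: nth_eq_iff_index_eq)
    have odd_even: "Suc (2 * i) \<noteq> 2 * j" for i j :: nat by presburger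
    show ?thesis using that unfolding tp
      by (auto simp: disjnt_def idx odd_even odd_even[symmetric])
  qed
  show "{} \<notin> twin_partition vs" unfolding twin_partition_def by auto
qed

lemma twin_partition_twins:
  assumes "twin_labeling G vs" "C \<in> twin_partition vs" "u \<in> C" "v \<in> C" "u \<noteq> v"
  shows "twins G u v"
  using assms by (auto simp: twin_partition_def twin_labeling_def intro: twins_sym)


section \<open>Connectedness from the simple spectrum\<close>

lemma zero_row_sums_root_char_poly:
  fixes A :: "'a :: field mat"
  assumes A: "A \<in> carrier_mat n n" and n: "n > 0"
    and rows: "\<And>i. i < n \<Longrightarrow> (\<Sum>j<n. A $$ (i, j)) = 0"
  shows "poly (char_poly A) 0 = 0"
proof -
  let ?v = "vec n (\<lambda>_. 1 :: 'a)"
  have "A *\<^sub>v ?v = 0 \<cdot>\<^sub>v ?v"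
    using A rows by (intro eq_vecI) (auto simp: scalar_prod_def lessThan_atLeast0)
  moreover have "?v \<noteq> 0\<^sub>v n" using n by (metis index_vec index_zero_vec(1) zero_neq_one)
  ultimately have "eigenvalue A 0"
    using A unfolding eigenvalue_def eigenvector_def by (intro exI[of _ ?v]) auto
  then show ?thesis by (simp add: eigenvalue_root_char_poly[OF A])
qed

lemma block_diagonal_char_poly:
  fixes A D :: "'a :: field mat"
  assumes A: "A \<in> carrier_mat k k" and D: "D \<in> carrier_mat m m"
  shows "char_poly (four_block_mat A (0\<^sub>m k m) (0\<^sub>m m k) D) = char_poly A * char_poly D"
proof -
  let ?M = "four_block_mat A (0\<^sub>m k m) (0\<^sub>m m k) D"
  have "char_poly_matrix ?M
      = four_block_mat (char_poly_matrix A) (0\<^sub>m k m) (0\<^sub>m m k) (char_poly_matrix D)"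
    using A D by (intro eq_matI) (auto simp: char_poly_matrix_def)
  then show ?thesis
    unfolding char_poly_def
    using det_four_block_mat_upper_right_zero[OF char_poly_matrix_closed[OF A] refl _ char_poly_matrix_closed[OF D]]
    by simp
qed

lemma block_diagonal_zero_row_sums_order:
  fixes A D :: "'a :: field mat"
  assumes A: "A \<in> carrier_mat k k" "k > 0" and D: "D \<in> carrier_mat m m" "m > 0"
    and rows: "\<And>i. i < k \<Longrightarrow> (\<Sum>j<k. A $$ (i, j)) = 0" "\<And>i. i < m \<Longrightarrow> (\<Sum>j<m. D $$ (i, j)) = 0"
  shows "Polynomial.order 0 (char_poly (four_block_mat A (0\<^sub>m k m) (0\<^sub>m m k) D)) \<ge> 2"
proof -
  have "char_poly A \<noteq> 0" "char_poly D \<noteq> 0"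
    using degree_monic_char_poly[OF A(1)] degree_monic_char_poly[OF D(1)] by auto
  moreover have "poly (char_poly A) 0 = 0" "poly (char_poly D) 0 = 0"
    using zero_row_sums_root_char_poly A D rows by blast+
  ultimately show ?thesis
    unfolding block_diagonal_char_poly[OF A(1) D(1)]
    by (subst order_mult) (auto simp: order_root Suc_le_eq)
qed

text \<open>The simple spectrum is assumed for every labeling, so the labeling may be chosen to list
  \<open>A\<close> first, which makes the matrix literally block diagonal.\<close>

lemma simple_spectrum_no_separation:
  assumes fin: "finite (pverts G)" and spec: "laplacian_simple_spectrum G"
    and A: "A \<subseteq> pverts G" "A \<noteq> {}" "A \<noteq> pverts G"
    and sep: "\<And>u w. u \<in> A \<Longrightarrow> w \<in> pverts G - A \<Longrightarrow> weight G u w = 0 \<and> weight G w u = 0"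
  shows False
proof -
  let ?V = "pverts G"
  obtain xs ys where xs: "set xs = A" "distinct xs" and ys: "set ys = ?V - A" "distinct ys"
    using finite_distinct_list fin A by (metis finite_subset finite_Diff)
  let ?ws = "xs @ ys" and ?k = "length xs" and ?m = "length ys"
  have ws: "labeling G ?ws" using xs ys A by (auto simp: labeling_def)
  define L where "L = map_mat complex_of_real (laplacian G ?ws)"
  have entry: "L $$ (i, j) = (if i = j then of_nat (deg G (?ws ! i)) else 0) - of_nat (weight G (?ws ! i) (?ws ! j))"
    if "i < ?k + ?m" "j < ?k + ?m" for i j
    using that by (simp add: L_def laplacian_def degree_matrix_def adjacency_matrix_def)
  have L: "L \<in> carrier_mat (?k + ?m) (?k + ?m)"
    using laplacian_carrier[of G ?ws] by (simp add: L_def)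
  have rows: "(\<Sum>j<?k + ?m. L $$ (i, j)) = 0" if i: "i < ?k + ?m" for i
  proof -
    have "(\<Sum>j<?k + ?m. L $$ (i, j)) = of_nat (deg G (?ws ! i)) - (\<Sum>j<length ?ws. of_nat (weight G (?ws ! i) (?ws ! j)))"
      using i by (simp add: entry sum_subtractf)
    also have "\<dots> = 0"
      by (simp del: length_append add: sum_labeling[OF ws, of "\<lambda>w. of_nat (weight G (?ws ! i) w)"] deg_def deg_into_def)
    finally show ?thesis .
  qed
  have off: "L $$ (i, ?k + j) = 0 \<and> L $$ (?k + j, i) = 0" if "i < ?k" "j < ?m" for i j
  proof -
    have "xs ! i \<in> A" "ys ! j \<in> ?V - A" using that xs ys nth_mem by blast+
    then show ?thesis using that sep by (simp add: entry nth_append)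
  qed
  let ?A = "mat ?k ?k (\<lambda>(i, j). L $$ (i, j))" and ?D = "mat ?m ?m (\<lambda>(i, j). L $$ (?k + i, ?k + j))"
  have block: "L = four_block_mat ?A (0\<^sub>m ?k ?m) (0\<^sub>m ?m ?k) ?D"
  proof (rule eq_matI)
    fix i j assume "i < dim_row (four_block_mat ?A (0\<^sub>m ?k ?m) (0\<^sub>m ?m ?k) ?D)"
      "j < dim_col (four_block_mat ?A (0\<^sub>m ?k ?m) (0\<^sub>m ?m ?k) ?D)"
    then have ij: "i < ?k + ?m" "j < ?k + ?m" by auto
    show "L $$ (i, j) = four_block_mat ?A (0\<^sub>m ?k ?m) (0\<^sub>m ?m ?k) ?D $$ (i, j)"
      using ij off[of i "j - ?k"] off[of j "i - ?k"] by auto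
  qed (use L in auto)
  have split: "(\<Sum>j<?k + m. g j) = (\<Sum>j<?k. g j) + (\<Sum>j<m. g (?k + j))"
    for g :: "nat \<Rightarrow> complex" and m
    by (induction m) (simp_all add: add.assoc)
  have "Polynomial.order 0 (char_poly L) \<ge> 2"
  proof (subst block, rule block_diagonal_zero_row_sums_order)
    show "?k > 0" "?m > 0" using A xs ys by auto
    show "(\<Sum>j<?k. ?A $$ (i, j)) = 0" if "i < ?k" for i
      using rows[of i] that by (simp add: split off)
    show "(\<Sum>j<?m. ?D $$ (i, j)) = 0" if "i < ?m" for i
      using rows[of "?k + i"] that by (simp add: split off)
  qed auto
  moreover have "eigenvalue L 0"
    using zero_row_sums_root_char_poly[OF L _ rows] A xs by (auto simp: eigenvalue_root_char_poly[OF L])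
  then have "Polynomial.order 0 (char_poly L) = 1"
    using spec ws by (auto simp: laplacian_simple_spectrum_def simple_spectrum_def Let_def L_def)
  ultimately show False by simp
qed

lemma simple_spectrum_imp_connected:
  assumes G: "simple_graph G" and spec: "laplacian_simple_spectrum G" and ne: "pverts G \<noteq> {}"
  shows "Digraph_Component.connected (with_proj (underlying G))"
proof -
  have "pair_graph (underlying G)" using G by (simp add: simple_graph_def)
  then interpret pair_graph "underlying G" .
  have V: "pverts (underlying G) = pverts G" and E: "parcs (underlying G) = parcs G"
    by (simp_all add: pair_pre_digraph.defs)
  show ?thesis
    unfolding connected_def
  proof (rule strongly_connectedI)
    show "verts (with_proj (mk_symmetric (with_proj (underlying G)))) \<noteq> {}" using ne V by simp
    fix u v assume "u \<in> verts (with_proj (mk_symmetric (with_proj (underlying G))))"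
      and "v \<in> verts (with_proj (mk_symmetric (with_proj (underlying G))))"
    then have uv: "u \<in> pverts G" "v \<in> pverts G" using V by auto
    define A where "A = {w. u \<rightarrow>\<^sup>*\<^bsub>underlying G\<^esub> w}"
    have AV: "A \<subseteq> pverts G" unfolding A_def using reachable_in_verts(2) V by auto
    have uA: "u \<in> A" unfolding A_def using uv V by (simp add: reachable_refl)
    have closed: "(a, w) \<notin> parcs G" if "a \<in> A" "w \<in> pverts G - A" for a w
      using that reachable_adj_trans[of u a w] E by (auto simp: A_def)
    have "v \<in> A"
    proof (rule ccontr)
      assume "v \<notin> A"
      show False
      proof (rule simple_spectrum_no_separation[OF simple_graph_finite[OF G] spec AV])
        fix a w assume "a \<in> A" "w \<in> pverts G - A"
        moreover then have "(w, a) \<notin> parcs G" using closed simple_graph_arcs_sym[OF G] by blast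
        ultimately show "weight G a w = 0 \<and> weight G w a = 0"
          using closed AV by (auto simp: simple_graph_weight[OF G])
      qed (use uA uv \<open>v \<notin> A\<close> in auto)
    qed
    then show "u \<rightarrow>\<^sup>*\<^bsub>with_proj (mk_symmetric (with_proj (underlying G)))\<^esub> v"
      unfolding A_def using reachable_mk_symmetricI by simp
  qed
qed


section \<open>Strong uncontrollability\<close>

theorem mainTheorem2:
  fixes G :: "'a wdigraph" and vs :: "'a list" and \<rho> :: "'a set set set"
  assumes "twin_graph G"
    and "odd (card (pverts G))"
    and "twin_labeling G vs"
    and "almost_equitable_partition (quotient_graph G (twin_partition vs)) \<rho>"
    and "nontrivial_partition \<rho>"
    and "{{last vs}} \<in> \<rho>"
  shows "strongly_uncontrollable G"
proof -
  let ?\<pi> = "twin_partition vs"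
  have G: "simple_graph G" and spec: "laplacian_simple_spectrum G"
    using assms(1) by (auto simp: twin_graph_def)
  have vs: "distinct vs" "set vs = pverts G"
    using assms(3) by (auto simp: twin_labeling_def labeling_def)
  then have "odd (length vs)" using assms(2) by (metis distinct_card)
  then obtain t where len: "length vs = 2 * t + 1" by (rule oddE)
  have "pverts G \<noteq> {}" using vs len by auto
  then have conn: "Digraph_Component.connected (with_proj (underlying G))"
    by (rule simple_spectrum_imp_connected[OF G spec])
  have part: "partition_on (pverts G) ?\<pi>"
    using twin_partition_partition_on[OF vs(1) len] vs(2) by simp
  have aep: "almost_equitable_partition G ?\<pi>"
    by (rule twin_cells_almost_equitable[OF G part twin_partition_twins[OF assms(3)]])
  have cells: "\<exists>u v. C = {u, v} \<and> twins G u v" if "C \<in> ?\<pi>" "C \<noteq> {last vs}" for C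
    using that assms(3) by (auto simp: twin_partition_def twin_labeling_def)
  have "\<not> controllable (laplacian G ws) b"
    if ws: "labeling G ws" and b: "b \<in> carrier_vec (card (pverts G))"
      and b01: "\<forall>i<card (pverts G). b $ i \<in> {0, 1}" for ws and b :: "real vec"
  proof -
    have n: "card (pverts G) = length ws"
      using ws by (metis distinct_card labeling_def)
    have bij: "bij_betw ((!) ws) {..<length ws} (pverts G)"
      using ws by (auto simp: labeling_def intro: bij_betw_nth)
    \<comment> \<open>The entries of \<open>b\<close> as a function on vertices.\<close>
    define \<beta> where "\<beta> u = b $ inv_into {..<length ws} ((!) ws) u" for u
    have \<beta>_nth: "\<beta> (ws ! i) = b $ i" if "i < length ws" for i
      using bij_betw_inv_into_left[OF bij] that by (simp add: \<beta>_def)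
    have b_eq: "b = vec (length ws) (\<lambda>i. \<beta> (ws ! i))"
      using b n by (intro eq_vecI) (auto simp: \<beta>_nth)
    have \<beta>01: "\<beta> u \<in> {0, 1}" if "u \<in> pverts G" for u
      using that b01 n \<beta>_nth ws by (metis in_set_conv_nth labeling_def)
    show ?thesis
    proof (cases "\<exists>u v. twins G u v \<and> \<beta> u = \<beta> v")
      case True
      then show ?thesis unfolding b_eq using twins_equal_not_controllable[OF G ws] by blast
    next
      case False
      show ?thesis unfolding b_eq
      proof (rule twin_separating_not_controllable[OF G ws aep _ assms(4-6)])
        fix C assume C: "C \<in> ?\<pi>" "C \<noteq> {last vs}"
        then obtain u v where uv: "C = {u, v}" "twins G u v" using cells by blast
        then have V: "u \<in> pverts G" "v \<in> pverts G" "u \<noteq> v" by (auto simp: twins_def)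
        show "card C = 2" using uv V by simp
        have "\<beta> u \<noteq> \<beta> v" using False uv by blast
        then show "sum \<beta> C = 1" using uv V \<beta>01[of u] \<beta>01[of v] by auto
      qed
    qed
  qed
  then show ?thesis
    unfolding strongly_uncontrollable_def using G conn spec by blast
qed

end
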